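(* Let $m,n\ge1$ be integers, $A\in\mathbb{R}^{m\times n}$, $b\in\mathbb{R}^m$, $\gamma>0$, $p\in[1,\infty)$, and let $\mu_k=\tau^k\mu_0$ for $k\ge0$, with $\mu_0>0$ and $\tau>1$. Let $v^0,\lambda^0\in\mathbb{R}^n$ and let $(u^k)_{k\geq 1}$, $(v^k)_{k\ge0}$, $(\lambda^k)_{k\ge0}$ be any sequences in $\mathbb{R}^n$ satisfying, for all $k\ge0$, the ADMM iteration $$\begin{aligned}u^{k+1}&\in\arg\min_{u\in\mathbb{R}^n}\ \gamma\,\|\nabla u\|_0+\tfrac{\mu_k}{2}\bigl\|u-\bigl(v^k-\tfrac{\lambda^k}{\mu_k}\bigr)\bigr\|_2^2,\\ v^{k+1}&=\arg\min_{v\in\mathbb{R}^n}\ \|Av-b\|_p^p+\tfrac{\mu_k}{2}\bigl\|v-\bigl(u^{k+1}+\tfrac{\lambda^k}{\mu_k}\bigr)\bigr\|_2^2,\\ \lambda^{k+1}&=\lambda^k+\mu_k\,(u^{k+1}-v^{k+1}).\end{aligned}$$ Then the iteration converges in the following sense: there is a vector $u^*\in\mathbb{R}^n$ such that $u^k\to u^*$, $v^k\to u^*$ and $\lambda^k/\mu_k\to0$ as $k\to\infty$.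
   Context: For $x\in\mathbb{R}^n$, $\|\nabla x\|_0=|\{i\in\{1,\dots,n-1\}:x_i\ne x_{i+1}\}|$ denotes the number of jumps of $x$, and $\|y\|_p^p=\sum_i|y_i|^p$. The functional in the second line is strictly convex and coercive, so its minimizer is unique; in the first line any minimizer may be chosen. The algorithm of the paper (iPotts-ADMM) is this iteration with initial values $v^0=A^*b$ (where $A^*$ is the transpose of $A$) and $\lambda^0=0$, stopped as soon as $\|u^k-v^k\|_2^2$ falls below a prescribed tolerance $\mathrm{TOL}>0$. *)

theory Defs
  imports "HOL-Analysis.Analysis"
begin

(* Vectors in R^n are elements of real ^ 'n for a finite linearly ordered index type 'n with
   CARD('n) = n. The order is what makes "consecutive entries" meaningful; nth_coord x i is the
   entry x_i in the numbering i = 1, ..., n of the indices in increasing order (junk for other i). *)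
definition nth_coord :: "'a ^ ('n::{finite,linorder}) \<Rightarrow> nat \<Rightarrow> 'a" where
  "nth_coord x i = x $ (sorted_list_of_set (UNIV :: 'n set) ! (i - 1))"

definition num_jumps :: "'a ^ ('n::{finite,linorder}) \<Rightarrow> nat" where
  "num_jumps x = card {i \<in> {1..CARD('n) - 1}. nth_coord x i \<noteq> nth_coord x (i + 1)}"

definition lp_norm_pow :: "real \<Rightarrow> real ^ 'm \<Rightarrow> real" where
  "lp_norm_pow p y = (\<Sum>i\<in>UNIV. \<bar>y $ i\<bar> powr p)"

end

theory Submission
  imports Defs
begin

text \<open>
  Write \<open>r\<^sub>k = u\<^sub>k\<^sub>+\<^sub>1 - (v\<^sub>k - \<lambda>\<^sub>k/\<mu>\<^sub>k)\<close>. Comparing \<open>u\<^sub>k\<^sub>+\<^sub>1\<close> with the centre of its own quadratic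
  term shows \<open>r\<^sub>k = O(\<mu>\<^sub>k\<^sup>-\<^sup>1\<^sup>/\<^sup>2)\<close>, because the number of jumps is bounded by the dimension.
  Substituting \<open>u\<^sub>k\<^sub>+\<^sub>1\<close> into the second line of the
  iteration, the multiplier cancels:
  \<open>v\<^sub>k\<^sub>+\<^sub>1\<close> is the proximal step for \<open>F(x) = \<parallel>Ax - b\<parallel>\<^sub>p\<^sup>p\<close> from the point \<open>v\<^sub>k + r\<^sub>k\<close>. The ADMM iteration
  is thus an inexact proximal point method with summable errors.

  Such a method converges for geometrically growing \<open>\<mu>\<^sub>k\<close> (lemma
  \<open>perturbed_proximal_steps\<close>). Comparing \<open>v\<^sub>k\<^sub>+\<^sub>1\<close> with \<open>v\<^sub>k + r\<^sub>k\<close> gives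
  \<open>F(v\<^sub>k\<^sub>+\<^sub>1) + \<mu>\<^sub>k/2 \<parallel>v\<^sub>k\<^sub>+\<^sub>1 - v\<^sub>k - r\<^sub>k\<parallel>\<^sup>2 \<le> F(v\<^sub>k + r\<^sub>k)\<close>. By Minkowski's inequality \<open>F\<^sup>1\<^sup>/\<^sup>p\<close> is Lipschitz,
  so along the iteration it increases by at most a multiple of \<open>\<parallel>r\<^sub>k\<parallel>\<close> per step and stays bounded;
  working with \<open>F\<^sup>1\<^sup>/\<^sup>p\<close> avoids any bound on the (sub)gradients of \<open>F\<close>. Hence
  \<open>v\<^sub>k\<^sub>+\<^sub>1 - v\<^sub>k - r\<^sub>k\<close> is also \<open>O(\<mu>\<^sub>k\<^sup>-\<^sup>1\<^sup>/\<^sup>2)\<close>, the increments of \<open>v\<close> are summable, and \<open>v\<close> converges.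
  Finally \<open>\<lambda>\<^sub>k\<^sub>+\<^sub>1 = - \<mu>\<^sub>k (v\<^sub>k\<^sub>+\<^sub>1 - v\<^sub>k - r\<^sub>k)\<close>, so \<open>\<lambda>\<^sub>k/\<mu>\<^sub>k\<close> tends to zero, and with it \<open>u\<^sub>k\<^sub>+\<^sub>1 - v\<^sub>k\<close>.
\<close>

section \<open>The Minkowski inequality for finite sums\<close>

definition lp_norm :: "real \<Rightarrow> real ^ 'm \<Rightarrow> real" where
  "lp_norm p y = lp_norm_pow p y powr (1 / p)"

lemma lp_norm_pow_nonneg: "lp_norm_pow p y \<ge> 0"
  unfolding lp_norm_pow_def by (intro sum_nonneg) auto

lemma lp_norm_nonneg: "lp_norm p y \<ge> 0"
  unfolding lp_norm_def by simp

lemma lp_norm_powr: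
  assumes "p > 0"
  shows "lp_norm p y powr p = lp_norm_pow p y"
  using assms lp_norm_pow_nonneg[of p y] by (simp add: lp_norm_def powr_powr)

lemma lp_norm_leI:
  assumes "p > 0" and "s \<ge> 0" and "lp_norm_pow p y \<le> s powr p"
  shows "lp_norm p y \<le> s"
proof -
  have "lp_norm p y \<le> (s powr p) powr (1 / p)"
    unfolding lp_norm_def using assms lp_norm_pow_nonneg by (intro powr_mono2) auto
  also have "\<dots> = s"
    using assms by (simp add: powr_powr)
  finally show ?thesis .
qed

lemma lp_norm_eq_0D:
  assumes "p > 0" and "lp_norm p y = 0"
  shows "y = 0"
proof -
  have "(\<Sum>i\<in>UNIV. \<bar>y $ i\<bar> powr p) = 0"
    using lp_norm_powr[OF assms(1), of y] assms(2) by (simp add: lp_norm_pow_def)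
  then have "\<forall>i. \<bar>y $ i\<bar> powr p = 0"
    by (simp add: sum_nonneg_eq_0_iff)
  then show ?thesis
    by (simp add: vec_eq_iff)
qed

text \<open>The convexity of \<open>x \<mapsto> x powr p\<close> on the open half-line, extended to the endpoint \<open>0\<close>, where
  it reduces to \<open>t powr p \<le> t\<close> for \<open>t \<le> 1\<close>.\<close>

lemma powr_convex_combination:
  fixes p s t x y :: real
  assumes "p \<ge> 1" and "s \<ge> 0" and "t \<ge> 0" and "s + t = 1" and "x \<ge> 0" and "y \<ge> 0"
  shows "(s * x + t * y) powr p \<le> s * x powr p + t * y powr p"
proof -
  have scale: "(c * z) powr p \<le> c * z powr p" if "0 \<le> c" "c \<le> 1" "0 \<le> z" for c z :: real
  proof -
    have "c powr p \<le> c"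
      using powr_mono'[of 1 p c] that assms(1) by simp
    then show ?thesis
      using that by (simp add: powr_mult mult_right_mono)
  qed
  consider "x = 0" | "y = 0" | "x > 0" "y > 0"
    using assms by linarith
  then show ?thesis
  proof cases
    case 1
    then show ?thesis using scale[of t y] assms by simp
  next
    case 2
    then show ?thesis using scale[of s x] assms by simp
  next
    case 3
    then show ?thesis
      using convex_onD[OF powr_convex[OF assms(1)], of t x y] assms
      by (simp add: eq_diff_eq[symmetric])
  qed
qed

text \<open>After normalisation both vectors have \<open>p\<close>-norm \<open>1\<close>, and the normalised sum is a convex
  combination of them, so convexity of \<open>x \<mapsto> x powr p\<close> applies entrywise.\<close>

lemma lp_norm_triangle:
  assumes "p \<ge> 1"
  shows "lp_norm p (x + y) \<le> lp_norm p x + lp_norm p y"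
proof (cases "lp_norm p x = 0 \<or> lp_norm p y = 0")
  case True
  then show ?thesis
    using lp_norm_eq_0D[of p x] lp_norm_eq_0D[of p y] assms lp_norm_nonneg by auto
next
  case False
  define a where "a = lp_norm p x"
  define c where "c = lp_norm p y"
  have pos: "a > 0" "c > 0"
    using False lp_norm_nonneg[of p x] lp_norm_nonneg[of p y] by (auto simp: a_def c_def)
  have pow: "lp_norm_pow p x = a powr p" "lp_norm_pow p y = c powr p"
    using assms by (simp_all add: a_def c_def lp_norm_powr)
  have entry: "\<bar>(x + y) $ i\<bar> powr p
      \<le> (a + c) powr p * (a / (a + c) * (\<bar>x $ i\<bar> powr p / a powr p)
          + c / (a + c) * (\<bar>y $ i\<bar> powr p / c powr p))" for i
  proof -
    have "\<bar>(x + y) $ i\<bar> \<le> (a + c) * (a / (a + c) * (\<bar>x $ i\<bar> / a) + c / (a + c) * (\<bar>y $ i\<bar> / c))"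
    proof -
      have "(a + c) * (a / (a + c) * (\<bar>x $ i\<bar> / a) + c / (a + c) * (\<bar>y $ i\<bar> / c))
          = \<bar>x $ i\<bar> + \<bar>y $ i\<bar>"
        using pos by (simp add: add_divide_distrib[symmetric])
      then show ?thesis
        using abs_triangle_ineq[of "x $ i" "y $ i"] by simp
    qed
    then have "\<bar>(x + y) $ i\<bar> powr p
        \<le> ((a + c) * (a / (a + c) * (\<bar>x $ i\<bar> / a) + c / (a + c) * (\<bar>y $ i\<bar> / c))) powr p"
      using assms by (intro powr_mono2) auto
    also have "\<dots> = (a + c) powr p
        * (a / (a + c) * (\<bar>x $ i\<bar> / a) + c / (a + c) * (\<bar>y $ i\<bar> / c)) powr p"
      using pos by (simp add: powr_mult)
    also have "\<dots> \<le> (a + c) powr p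
        * (a / (a + c) * (\<bar>x $ i\<bar> / a) powr p + c / (a + c) * (\<bar>y $ i\<bar> / c) powr p)"
      using pos assms
      by (intro mult_left_mono powr_convex_combination) (auto simp: add_divide_distrib[symmetric])
    finally show ?thesis
      using pos by (simp add: powr_divide)
  qed
  have "lp_norm_pow p (x + y)
      \<le> (\<Sum>i\<in>UNIV. (a + c) powr p * (a / (a + c) * (\<bar>x $ i\<bar> powr p / a powr p)
          + c / (a + c) * (\<bar>y $ i\<bar> powr p / c powr p)))"
    unfolding lp_norm_pow_def by (intro sum_mono entry)
  also have "\<dots> = (a + c) powr p * (a / (a + c) * (lp_norm_pow p x / a powr p)
          + c / (a + c) * (lp_norm_pow p y / c powr p))"
    by (simp only: lp_norm_pow_def sum.distrib sum_divide_distrib sum_distrib_left distrib_left)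
  also have "\<dots> = (a + c) powr p"
    using pos by (simp add: pow add_divide_distrib[symmetric])
  finally show ?thesis
    using assms pos by (intro lp_norm_leI) (auto simp: a_def c_def)
qed

lemma lp_norm_le_norm:
  fixes y :: "real ^ 'm"
  assumes "p > 0"
  shows "lp_norm p y \<le> real CARD('m) powr (1 / p) * norm y"
proof (rule lp_norm_leI)
  have "lp_norm_pow p y \<le> (\<Sum>i\<in>(UNIV::'m set). norm y powr p)"
    unfolding lp_norm_pow_def
    using assms component_le_norm_cart[of y] by (intro sum_mono powr_mono2) auto
  then show "lp_norm_pow p y \<le> (real CARD('m) powr (1 / p) * norm y) powr p"
    using assms by (simp add: powr_mult powr_powr)
qed (use assms in auto)

lemma lp_residual_lipschitz:
  fixes A :: "real ^ 'n ^ 'm"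
  assumes "p \<ge> 1"
  obtains L where "L \<ge> 0"
    and "\<And>x r. lp_norm p (A *v (x + r) - b) \<le> lp_norm p (A *v x - b) + L * norm r"
proof -
  obtain K where K: "K > 0" "\<And>r. norm (A *v r) \<le> norm r * K"
    using bounded_linear.pos_bounded[OF matrix_vector_mul_bounded_linear[of A]] by blast
  define c where "c = real CARD('m) powr (1 / p)"
  have "lp_norm p (A *v (x + r) - b) \<le> lp_norm p (A *v x - b) + c * K * norm r" for x r
  proof -
    have "lp_norm p (A *v (x + r) - b) = lp_norm p ((A *v x - b) + A *v r)"
      by (simp add: matrix_vector_right_distrib algebra_simps)
    also have "\<dots> \<le> lp_norm p (A *v x - b) + lp_norm p (A *v r)"
      by (rule lp_norm_triangle[OF assms])
    also have "lp_norm p (A *v r) \<le> c * norm (A *v r)"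
      unfolding c_def using assms by (intro lp_norm_le_norm) auto
    also have "\<dots> \<le> c * (norm r * K)"
      by (intro mult_left_mono K) (simp add: c_def)
    finally show ?thesis by (simp add: algebra_simps)
  qed
  moreover have "c * K \<ge> 0" using K by (simp add: c_def)
  ultimately show ?thesis using that by blast
qed

section \<open>Proximal steps with geometrically growing parameters\<close>

lemma convergent_if_geometric_increments:
  fixes x :: "nat \<Rightarrow> 'a::banach"
  assumes "\<And>k. norm (x (Suc k) - x k) \<le> C * q ^ k" and "0 \<le> q" and "q < 1"
  shows "convergent x"
proof -
  have "summable (\<lambda>k. C * q ^ k)"
    using assms(2,3) by (intro summable_mult summable_geometric) auto
  then have "summable (\<lambda>k. x (Suc k) - x k)"
    using assms(1) by (rule summable_comparison_test'[of _ 0])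
  then have "convergent (\<lambda>n. \<Sum>k<n. x (Suc k) - x k)"
    by (simp add: summable_iff_convergent)
  then have "convergent (\<lambda>n. x n - x 0)"
    by (simp add: sum_lessThan_telescope)
  then show ?thesis
    by (simp add: convergent_diff_const_right_iff)
qed

text \<open>A bounded quadratic penalty confines \<open>e\<close> to the scale \<open>\<mu>\<^sup>-\<^sup>1\<^sup>/\<^sup>2\<close>. That scale is written as a multiple
  of \<open>s\<close> because \<open>s\<close> will be \<open>q ^ k\<close> with \<open>q = 1 / sqrt \<tau>\<close>, for which the first hypothesis says
  \<open>\<mu> = \<tau> ^ k * m\<close>.\<close>

lemma quadratic_penalty_bound:
  fixes \<mu> s m e K :: real
  assumes "\<mu> * s\<^sup>2 = m" and "m > 0" and "s \<ge> 0" and "K \<ge> 0" and "\<mu> / 2 * e\<^sup>2 \<le> K"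
  shows "e \<le> sqrt (2 * K / m) * s"
proof (rule power2_le_imp_le)
  have "m / 2 * e\<^sup>2 = (\<mu> / 2 * e\<^sup>2) * s\<^sup>2"
    unfolding assms(1)[symmetric] by simp
  also have "\<dots> \<le> K * s\<^sup>2"
    by (intro mult_right_mono assms) simp
  finally have "m / 2 * e\<^sup>2 \<le> K * s\<^sup>2" .
  then have "e\<^sup>2 \<le> 2 * K / m * s\<^sup>2"
    using assms(2) by (simp add: field_simps)
  then show "e\<^sup>2 \<le> (sqrt (2 * K / m) * s)\<^sup>2"
    using assms(2,4) by (simp add: power_mult_distrib)
qed (use assms in auto)

text \<open>An inexact proximal point method for \<open>N powr p\<close> with errors \<open>r k\<close>. The step inequality is what
  a minimiser satisfies when compared with the centre \<open>x k + r k\<close> of the quadratic term. Dropping the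
  quadratic term shows that \<open>N\<close> grows by at most \<open>L * norm (r k)\<close> per step, hence stays bounded;
  the step inequality then bounds \<open>\<mu> k\<close> times the squared step, so the steps decay like \<open>q ^ k\<close> and are summable.\<close>

lemma perturbed_proximal_steps:
  fixes N :: "'a::banach \<Rightarrow> real" and x r :: "nat \<Rightarrow> 'a"
  assumes nonneg: "\<And>y. N y \<ge> 0"
    and lip: "\<And>y z. N (y + z) \<le> N y + L * norm z" and "L \<ge> 0"
    and "p > 0" and q: "0 \<le> q" "q < 1" and "m > 0"
    and mu: "\<And>k. \<mu> k * (q ^ k)\<^sup>2 = m" and mu_pos: "\<And>k. \<mu> k > 0"
    and err: "\<And>k. norm (r k) \<le> C * q ^ k"
    and step: "\<And>k. N (x (Suc k)) powr p + \<mu> k / 2 * (norm (x (Suc k) - (x k + r k)))\<^sup>2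
                 \<le> N (x k + r k) powr p"
  shows "convergent x" and "(\<lambda>k. x (Suc k) - (x k + r k)) \<longlonglongrightarrow> 0"
proof -
  have C: "C \<ge> 0"
    using order_trans[OF norm_ge_zero err[of 0]] by simp
  have shift: "N (x k + r k) \<le> N (x k) + L * C * q ^ k" for k
    using lip[of "x k" "r k"] mult_left_mono[OF err \<open>L \<ge> 0\<close>, of k] by (simp add: mult.assoc)
  have descent: "N (x (Suc k)) \<le> N (x k + r k)" for k
  proof (rule ccontr)
    assume "\<not> ?thesis"
    then have "N (x k + r k) powr p < N (x (Suc k)) powr p"
      using nonneg \<open>p > 0\<close> by (intro powr_less_mono2) auto
    moreover have "\<mu> k / 2 * (norm (x (Suc k) - (x k + r k)))\<^sup>2 \<ge> 0"
      using mu_pos[of k] by simp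
    ultimately show False
      using step[of k] by linarith
  qed
  have growth: "N (x k) \<le> N (x 0) + L * C * (\<Sum>i<k. q ^ i)" for k
  proof (induction k)
    case (Suc k)
    then show ?case
      using descent[of k] shift[of k] by (simp add: algebra_simps)
  qed simp
  define B where "B = N (x 0) + L * C / (1 - q) + L * C"
  have bounded: "N (x k + r k) \<le> B" for k
  proof -
    have "(\<Sum>i<k. q ^ i) \<le> 1 / (1 - q)"
      using q sum_le_suminf[of "\<lambda>i. q ^ i" "{..<k}"] by (simp add: suminf_geometric)
    then have "L * C * (\<Sum>i<k. q ^ i) \<le> L * C / (1 - q)"
      using mult_left_mono[of _ "1 / (1 - q)" "L * C"] \<open>L \<ge> 0\<close> C by simp
    moreover have "L * C * q ^ k \<le> L * C"
      using q \<open>L \<ge> 0\<close> C by (simp add: mult_left_le power_le_one)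
    ultimately show ?thesis
      using shift[of k] growth[of k] by (simp add: B_def)
  qed
  define D where "D = sqrt (2 * B powr p / m)"
  have decay: "norm (x (Suc k) - (x k + r k)) \<le> D * q ^ k" for k
    unfolding D_def
  proof (rule quadratic_penalty_bound[OF mu \<open>m > 0\<close>])
    have "N (x k + r k) powr p \<le> B powr p"
      using bounded nonneg \<open>p > 0\<close> by (intro powr_mono2) auto
    then show "\<mu> k / 2 * (norm (x (Suc k) - (x k + r k)))\<^sup>2 \<le> B powr p"
      using step[of k] powr_ge_zero[of "N (x (Suc k))" p] by linarith
  qed (use q in auto)
  have "norm (x (Suc k) - x k) \<le> (D + C) * q ^ k" for k
  proof -
    have "norm (x (Suc k) - x k) \<le> norm (x (Suc k) - (x k + r k)) + norm (r k)"
      using norm_triangle_ineq[of "x (Suc k) - (x k + r k)" "r k"] by simp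
    then show ?thesis
      using decay[of k] err[of k] by (simp add: algebra_simps)
  qed
  then show "convergent x"
    using q by (rule convergent_if_geometric_increments)
  have "(\<lambda>k. D * q ^ k) \<longlonglongrightarrow> 0"
    using q by (intro tendsto_mult_right_zero LIMSEQ_power_zero) auto
  then show "(\<lambda>k. x (Suc k) - (x k + r k)) \<longlonglongrightarrow> 0"
    by (rule Lim_null_comparison[rotated]) (simp add: decay)
qed

section \<open>Convergence of the iteration\<close>

lemma num_jumps_le_card:
  fixes x :: "'a ^ ('n::{finite,linorder})"
  shows "num_jumps x \<le> CARD('n)"
proof -
  have "num_jumps x \<le> card {1..CARD('n) - 1}"
    unfolding num_jumps_def by (intro card_mono) auto
  then show ?thesis by simp
qed

theorem theorem6:
  fixes A :: "real ^ ('n::{finite,linorder}) ^ 'm"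
    and b :: "real ^ 'm"
    and \<gamma> p \<tau> \<mu>0 :: real
    and \<mu> :: "nat \<Rightarrow> real"
    and u v lam :: "nat \<Rightarrow> real ^ ('n::{finite,linorder})"
  assumes "\<gamma> > 0" and "p \<ge> 1" and "\<mu>0 > 0" and "\<tau> > 1"
    and "\<And>k. \<mu> k = \<tau> ^ k * \<mu>0"
    and "\<And>k. is_arg_min
           (\<lambda>x. \<gamma> * real (num_jumps x)
                 + \<mu> k / 2 * (norm (x - (v k - lam k /\<^sub>R \<mu> k)))\<^sup>2)
           (\<lambda>_. True) (u (Suc k))"
    and "\<And>k. is_arg_min
           (\<lambda>x. lp_norm_pow p (A *v x - b)
                 + \<mu> k / 2 * (norm (x - (u (Suc k) + lam k /\<^sub>R \<mu> k)))\<^sup>2)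
           (\<lambda>_. True) (v (Suc k))"
    and "\<And>k. lam (Suc k) = lam k + \<mu> k *\<^sub>R (u (Suc k) - v (Suc k))"
  shows "\<exists>ustar. u \<longlonglongrightarrow> ustar \<and> v \<longlonglongrightarrow> ustar \<and> (\<lambda>k. lam k /\<^sub>R \<mu> k) \<longlonglongrightarrow> 0"
proof -
  \<comment> \<open>With this choice \<open>q ^ k\<close> is proportional to \<open>\<mu>\<^sub>k\<^sup>-\<^sup>1\<^sup>/\<^sup>2\<close>, the size of all errors below.\<close>
  define q where "q = 1 / sqrt \<tau>"
  have q: "0 \<le> q" "q < 1"
    using \<open>\<tau> > 1\<close> by (auto simp: q_def)
  have mu_pos: "\<mu> k > 0" for k
    using assms(3,4,5) by simp
  have mu_scale: "\<mu> k * (q ^ k)\<^sup>2 = \<mu>0" for k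
  proof -
    have "(q ^ k)\<^sup>2 = (q\<^sup>2) ^ k"
      by (simp add: power_mult[symmetric] mult.commute)
    then show ?thesis
      using assms(4,5) by (simp add: q_def power_divide)
  qed
  define r where "r k = u (Suc k) - (v k - lam k /\<^sub>R \<mu> k)" for k
  define N where "N y = lp_norm p (A *v y - b)" for y
  define K where "K = \<gamma> * real CARD('n)"
  have err: "norm (r k) \<le> sqrt (2 * K / \<mu>0) * q ^ k" for k
  proof (rule quadratic_penalty_bound[OF mu_scale \<open>\<mu>0 > 0\<close>])
    let ?w = "v k - lam k /\<^sub>R \<mu> k"
    have "\<gamma> * real (num_jumps (u (Suc k))) + \<mu> k / 2 * (norm (r k))\<^sup>2 \<le> \<gamma> * real (num_jumps ?w)"
      using assms(6)[of k] unfolding is_arg_min_linorder r_def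
      by (auto dest!: spec[of _ ?w])
    moreover have "\<gamma> * real (num_jumps ?w) \<le> K"
      unfolding K_def using num_jumps_le_card[of ?w] \<open>\<gamma> > 0\<close> by (intro mult_left_mono) auto
    moreover have "\<gamma> * real (num_jumps (u (Suc k))) \<ge> 0"
      using \<open>\<gamma> > 0\<close> by simp
    ultimately show "\<mu> k / 2 * (norm (r k))\<^sup>2 \<le> K"
      by linarith
  qed (use q \<open>\<gamma> > 0\<close> in \<open>auto simp: K_def\<close>)
  \<comment> \<open>The multiplier cancels, so the second minimisation is a proximal step from \<open>v k + r k\<close>.\<close>
  have centre: "u (Suc k) + lam k /\<^sub>R \<mu> k = v k + r k" for k
    by (simp add: r_def)
  have step: "N (v (Suc k)) powr p + \<mu> k / 2 * (norm (v (Suc k) - (v k + r k)))\<^sup>2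
      \<le> N (v k + r k) powr p" for k
    using assms(7)[of k] \<open>p \<ge> 1\<close> unfolding is_arg_min_linorder centre N_def
    by (auto simp: lp_norm_powr dest!: spec[of _ "v k + r k"])
  obtain L where "L \<ge> 0" and "\<And>y z. N (y + z) \<le> N y + L * norm z"
    using lp_residual_lipschitz[OF \<open>p \<ge> 1\<close>] unfolding N_def by metis
  moreover have "N y \<ge> 0" for y
    by (simp add: N_def lp_norm_nonneg)
  moreover have "p > 0"
    using \<open>p \<ge> 1\<close> by simp
  ultimately have "convergent v" and d0: "(\<lambda>k. v (Suc k) - (v k + r k)) \<longlonglongrightarrow> 0"
    using perturbed_proximal_steps[of N L p q \<mu>0 \<mu> r _ v] q \<open>\<mu>0 > 0\<close> mu_scale mu_pos err step
    by blast+
  then obtain x where v: "v \<longlonglongrightarrow> x"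
    by (auto simp: convergent_def)
  have "lam (Suc k) /\<^sub>R \<mu> (Suc k) = - (v (Suc k) - (v k + r k)) /\<^sub>R \<tau>" for k
  proof -
    have "lam (Suc k) = \<mu> k *\<^sub>R ((u (Suc k) + lam k /\<^sub>R \<mu> k) - v (Suc k))"
      using assms(8)[of k] mu_pos[of k] by (simp add: algebra_simps)
    then have "lam (Suc k) = \<mu> k *\<^sub>R (- (v (Suc k) - (v k + r k)))"
      by (simp add: centre)
    moreover have "\<mu> (Suc k) = \<tau> * \<mu> k"
      using assms(5) by simp
    ultimately show ?thesis
      using mu_pos[of k] by simp
  qed
  moreover have "(\<lambda>k. - (v (Suc k) - (v k + r k)) /\<^sub>R \<tau>) \<longlonglongrightarrow> 0"
    using tendsto_scaleR[OF tendsto_const tendsto_minus[OF d0]] by simp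
  ultimately have lam: "(\<lambda>k. lam k /\<^sub>R \<mu> k) \<longlonglongrightarrow> 0"
    by (simp add: LIMSEQ_imp_Suc[of "\<lambda>k. lam k /\<^sub>R \<mu> k"])
  have "(\<lambda>k. sqrt (2 * K / \<mu>0) * q ^ k) \<longlonglongrightarrow> 0"
    using q by (intro tendsto_mult_right_zero LIMSEQ_power_zero) auto
  then have "r \<longlonglongrightarrow> 0"
    by (rule Lim_null_comparison[rotated]) (simp add: err)
  then have "(\<lambda>k. v k - lam k /\<^sub>R \<mu> k + r k) \<longlonglongrightarrow> x - 0 + 0"
    by (intro tendsto_intros v lam)
  then have "(\<lambda>k. u (Suc k)) \<longlonglongrightarrow> x"
    by (simp add: r_def)
  then have "u \<longlonglongrightarrow> x"
    by (rule LIMSEQ_imp_Suc)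
  with v lam show ?thesis by blast
qed

end
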